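(* Let $0<r<1$ and $A_r=\{z\in\mathbb{C}: r<|z|<1\}$. Viewed as a function on $[\sqrt{r}, 1)$, the squeezing function $s_{A_r}$ of $A_r$ is strictly increasing on $[\sqrt{r}, 1)$; in particular, it attains its minimum at $\sqrt{r}$.
   Context: $\Delta$ is the open unit disc and $\Delta_t$ the open disc with center $0$ and radius $t$. For a bounded domain $D\subset\mathbb{C}$ and $p\in D$, the squeezing function is $s_D(p)=\sup_f\,\sup\{t:\Delta_t\subset f(D)\}$, where the outer supremum is over all injective holomorphic maps $f:D\to\Delta$ with $f(p)=0$. By conformal invariance $s_{A_r}(z)$ depends only on $|z|$ and is invariant under $z\mapsto r/z$, so $s_{A_r}$ is determined by its restriction to the real interval $[\sqrt r,1)$; this restriction is what is meant by viewing $s_{A_r}$ as a function on $[\sqrt r,1)$. *)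

theory Defs
  imports "HOL-Complex_Analysis.Complex_Analysis"
begin

definition disc_embeddings :: "complex set \<Rightarrow> complex \<Rightarrow> (complex \<Rightarrow> complex) set" where
  "disc_embeddings D p =
     {f. f holomorphic_on D \<and> inj_on f D \<and> f ` D \<subseteq> ball 0 1 \<and> f p = 0}"

(* Both suprema are taken in the reals. For a bounded domain D and p in D they range over
   nonempty sets bounded above by 1: a suitable affine map is an admissible f, and the inner
   set contains 0 (the disc of radius 0 is empty). Elsewhere the value is unspecified. *)
definition squeezing_function :: "complex set \<Rightarrow> complex \<Rightarrow> real" where
  "squeezing_function D p =
     (SUP f\<in>disc_embeddings D p. Sup {t. 0 \<le> t \<and> ball 0 t \<subseteq> f ` D})"

definition annulus :: "real \<Rightarrow> complex set" where
  "annulus r = {z. r < norm z \<and> norm z < 1}"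

end

theory Submission
  imports Defs
begin

text \<open>For \<open>sqrt r \<le> x < 1\<close> the squeezing function of the annulus at \<open>x\<close> equals \<open>x\<close>. The lower bound comes
  from an explicit infinite product \<open>F\<close> with a simple zero at \<open>x\<close> and with \<open>|F| = 1\<close> on \<open>|z| = 1\<close>,
  \<open>|F| = x\<close> on \<open>|z| = r\<close>; by the argument principle it maps the annulus injectively onto the unit
  disc minus an arc of \<open>|w| = x\<close>. For the upper bound, let \<open>f\<close> be any admissible embedding whose
  image contains the disc of radius \<open>t\<close>. Then \<open>f / F\<close> has no zeros, so the mean of \<open>ln |f / F|\<close> over
  \<open>|z| = \<rho>\<close> is \<open>c + m ln \<rho>\<close> for an integer \<open>m\<close>. Near the boundary \<open>|f|\<close> lies between \<open>t\<close> and \<open>1\<close>;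
  comparing the means on the two boundary circles gives \<open>t \<le> x\<close> if \<open>m \<ge> 0\<close> and \<open>t \<le> r / x \<le> x\<close> if
  \<open>m < 0\<close>.\<close>

subsection \<open>The circular slit map\<close>

text \<open>This is the infinite q-Pochhammer symbol (z; q), the building block of theta
  functions.\<close>

definition qprod :: "real \<Rightarrow> complex \<Rightarrow> complex" where
  "qprod q z = (\<Prod>n. 1 - of_real (q ^ n) * z)"

lemma convergent_qprod:
  assumes "0 < q" "q < 1"
  shows "convergent_prod (\<lambda>n. 1 - of_real (q ^ n) * z :: complex)"
proof (rule abs_convergent_prod_imp_convergent_prod)
  have "summable (\<lambda>n. q ^ n * norm z)"
    using assms by (intro summable_mult2 summable_geometric) auto
  then show "abs_convergent_prod (\<lambda>n. 1 - of_real (q ^ n) * z)"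
    using assms by (simp add: abs_convergent_prod_conv_summable norm_mult norm_power)
qed

lemma qprod_eq_0_iff:
  assumes "0 < q" "q < 1"
  shows "qprod q z = 0 \<longleftrightarrow> (\<exists>n. of_real (q ^ n) * z = 1)"
proof -
  have "(\<lambda>n. 1 - of_real (q ^ n) * z) has_prod qprod q z"
    unfolding qprod_def using convergent_qprod[OF assms] by (rule convergent_prod_has_prod)
  from has_prod_eq_0_iff[OF this]
  have "qprod q z = 0 \<longleftrightarrow> (\<exists>n. 1 - of_real (q ^ n) * z = 0)"
    unfolding image_iff by (simp add: eq_commute[of 0])
  then show ?thesis
    by simp
qed

lemma qprod_nonzero:
  assumes "0 < q" "q < 1" "norm z < 1"
  shows "qprod q z \<noteq> 0"
proof
  assume "qprod q z = 0"
  then obtain n where "of_real (q ^ n) * z = 1"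
    using qprod_eq_0_iff assms by blast
  then have "norm (of_real (q ^ n) * z) = 1" by simp
  then have "q ^ n * norm z = 1"
    using assms by (simp add: norm_mult norm_power)
  moreover have "q ^ n * norm z \<le> 1 * norm z"
    using assms by (intro mult_right_mono power_le_one) auto
  ultimately show False using assms by simp
qed

text \<open>Splitting off the factor n = 0 shifts the argument from z to qz. The value z = 1 is
  treated separately, since the head of the product can be divided out only when it is
  nonzero.\<close>

lemma qprod_rec:
  assumes "0 < q" "q < 1"
  shows "qprod q z = (1 - z) * qprod q (of_real q * z)"
proof (cases "z = 1")
  case True
  then have "qprod q z = 0"
    using qprod_eq_0_iff[OF assms, of z] by (auto intro: exI[of _ 0])
  then show ?thesis using True by simp
next
  case False
  have "(\<Prod>n. 1 - of_real (q ^ Suc n) * z) = qprod q z / (1 - z)"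
    unfolding qprod_def
    using prodinf_split_head[OF convergent_qprod[OF assms, of z]] False by simp
  moreover have "(\<Prod>n. 1 - of_real (q ^ Suc n) * z) = qprod q (of_real q * z)"
    unfolding qprod_def by (simp add: algebra_simps)
  ultimately show ?thesis using False by (simp add: field_simps)
qed

text \<open>The coefficients q^n are real, so conjugation passes through every partial product and
  hence through the limit. This turns reflections in circles into identities between values of
  \<open>qprod\<close>.\<close>

lemma cnj_qprod:
  assumes "0 < q" "q < 1"
  shows "cnj (qprod q z) = qprod q (cnj z)"
proof -
  have "(\<lambda>n. \<Prod>i\<le>n. 1 - of_real (q ^ i) * z) \<longlonglongrightarrow> qprod q z"
    unfolding qprod_def by (intro convergent_prod_LIMSEQ convergent_qprod assms)
  then have "(\<lambda>n. cnj (\<Prod>i\<le>n. 1 - of_real (q ^ i) * z)) \<longlonglongrightarrow> cnj (qprod q z)"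
    by (rule tendsto_cnj)
  moreover have "(\<lambda>n. \<Prod>i\<le>n. 1 - of_real (q ^ i) * cnj z) \<longlonglongrightarrow> qprod q (cnj z)"
    unfolding qprod_def by (intro convergent_prod_LIMSEQ convergent_qprod assms)
  ultimately show ?thesis
    by (intro LIMSEQ_unique) (simp_all add: cnj_prod)
qed

text \<open>On the closed unit disc around z the n-th factor differs from 1 by at most q^n (|z| +
  1). The M-test then makes the partial products converge locally uniformly.\<close>

lemma holomorphic_qprod:
  assumes "0 < q" "q < 1"
  shows "qprod q holomorphic_on UNIV"
proof (rule holomorphic_uniform_sequence[where f = "\<lambda>N z. \<Prod>n<N. 1 - of_real (q ^ n) * z"])
  show "(\<lambda>z. \<Prod>n<N. 1 - of_real (q ^ n) * z) holomorphic_on UNIV" for N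
    by (intro holomorphic_intros)
  fix z :: complex
  define K where "K = cball z 1"
  define R where "R = norm z + 1"
  have norm_le: "norm w \<le> R" if "w \<in> K" for w
    using that norm_triangle_ineq2[of w z] by (simp add: K_def R_def dist_norm norm_minus_commute)
  have "uniformly_convergent_on K (\<lambda>N w. \<Sum>n<N. norm ((1 - of_real (q ^ n) * w) - 1))"
  proof (rule Weierstrass_m_test')
    show "summable (\<lambda>n. q ^ n * R)"
      using assms by (intro summable_mult2 summable_geometric) auto
    show "norm (norm ((1 - of_real (q ^ n) * w) - 1)) \<le> q ^ n * R" if "w \<in> K" for n w
      using norm_le[OF that] assms by (simp add: norm_mult norm_power mult_left_mono)
  qed
  then have "uniformly_convergent_on K (\<lambda>N w. \<Prod>n<N. 1 - of_real (q ^ n) * w)"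
    by (intro uniformly_convergent_on_prod') (auto simp: K_def intro!: continuous_intros)
  then have "uniform_limit K (\<lambda>N w. \<Prod>n<N. 1 - of_real (q ^ n) * w)
               (\<lambda>w. lim (\<lambda>N. \<Prod>n<N. 1 - of_real (q ^ n) * w)) sequentially"
    by (simp add: uniformly_convergent_uniform_limit_iff)
  moreover have "lim (\<lambda>N. \<Prod>n<N. 1 - of_real (q ^ n) * w) = qprod q w" for w
  proof (rule limI)
    show "(\<lambda>N. \<Prod>n<N. 1 - of_real (q ^ n) * w) \<longlonglongrightarrow> qprod q w"
      unfolding qprod_def LIMSEQ_lessThan_iff_atMost
      by (intro convergent_prod_LIMSEQ convergent_qprod assms)
  qed
  ultimately show "\<exists>d>0. cball z d \<subseteq> UNIV \<and>
      uniform_limit (cball z d) (\<lambda>N w. \<Prod>n<N. 1 - of_real (q ^ n) * w) (qprod q) sequentially"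
    unfolding K_def by (intro exI[of _ 1]) auto
qed auto

lemma holomorphic_qprod_comp [holomorphic_intros]:
  assumes "0 < q" "q < 1" "f holomorphic_on S"
  shows "(\<lambda>z. qprod q (f z)) holomorphic_on S"
  using holomorphic_on_compose_gen[OF assms(3) holomorphic_qprod[OF assms(1,2)]]
  by (simp add: o_def)

text \<open>The zeros are the points \<open>x q ^ n\<close> and the poles the points \<open>q ^ n / x\<close> with \<open>q = r ^ 2\<close> and \<open>n\<close> an integer, so that
  reflection in \<open>|z| = 1\<close> and in \<open>|z| = r\<close> exchanges numerator and denominator up to an
  elementary factor; this makes the modulus constant on both circles.\<close>

definition slit_map :: "real \<Rightarrow> real \<Rightarrow> complex \<Rightarrow> complex" where
  "slit_map r x z =
     x * (qprod (r\<^sup>2) (z / x) * qprod (r\<^sup>2) (r\<^sup>2 * x / z))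
       / (qprod (r\<^sup>2) (z * x) * qprod (r\<^sup>2) (r\<^sup>2 / (z * x)))"

context
  fixes r x :: real
  assumes rx: "0 < r" "r < x" "x < 1"
begin

private lemma q: "0 < r\<^sup>2" "r\<^sup>2 < 1" "r\<^sup>2 / x < r" "r < 1" "0 < x" "1 < 1 / x"
  "r\<^sup>2 * x < r\<^sup>2 / x" "0 < r" "r\<^sup>2 < x"
proof -
  show "r\<^sup>2 / x < r" "0 < x" "0 < r\<^sup>2" "1 < 1 / x" "0 < r"
    using rx by (auto simp: power2_eq_square field_simps)
  show "r\<^sup>2 < 1" "r < 1" using rx by (auto simp: power_less_one_iff)
  have "x * x < 1" using rx mult_strict_mono[of x 1 x 1] by simp
  show "r\<^sup>2 < x" using rx mult_strict_mono[of r x r 1] by (simp add: power2_eq_square)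
  show "r\<^sup>2 * x < r\<^sup>2 / x" using rx \<open>x * x < 1\<close> by (simp add: field_simps)
qed

text \<open>The bounds place both arguments in the unit disc, where \<open>qprod\<close> has no
  zeros. They describe the annulus between the two nearest poles, which contains r <= |z| <= 1
  because r < x < 1.\<close>

lemma slit_map_denominator_nonzero:
  fixes z :: complex
  assumes "r\<^sup>2 / x < norm z" "norm z < 1 / x"
  shows "qprod (r\<^sup>2) (z * x) \<noteq> 0" "qprod (r\<^sup>2) (r\<^sup>2 / (z * x)) \<noteq> 0"
proof -
  have "0 < norm z" using assms q by (smt (verit) divide_pos_pos)
  then have "norm (z * x) < 1" "norm (of_real (r\<^sup>2) / (z * x)) < 1"
    using assms q by (auto simp: norm_mult norm_divide norm_power field_simps)
  then show "qprod (r\<^sup>2) (z * x) \<noteq> 0" "qprod (r\<^sup>2) (r\<^sup>2 / (z * x)) \<noteq> 0"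
    using qprod_nonzero q by blast+
qed

lemma holomorphic_slit_map:
  "slit_map r x holomorphic_on {z. r\<^sup>2 / x < norm z \<and> norm z < 1 / x}"
proof -
  have "z \<noteq> 0" if "r\<^sup>2 / x < norm z" for z :: complex
    using that q by (auto simp: field_simps)
  then show ?thesis
    unfolding slit_map_def[abs_def] using q slit_map_denominator_nonzero
    by (intro holomorphic_intros) auto
qed

text \<open>Every other zero of the numerator lies outside the given annulus: those of the first
  factor have modulus at least x / r^2 > 1 / x, and those of the second have modulus at most r^2 x <
  r^2 / x.\<close>

lemma slit_map_eq_0_iff:
  fixes z :: complex
  assumes "r\<^sup>2 / x < norm z" "norm z < 1 / x"
  shows "slit_map r x z = 0 \<longleftrightarrow> z = x"
proof -
  have z: "z \<noteq> 0" using assms q by (auto simp: field_simps)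
  have pow: "(r\<^sup>2) ^ Suc n \<le> r\<^sup>2" for n
    using q by (metis mult.right_neutral mult_left_mono power_Suc power_le_one less_imp_le)
  have "z = x" if "of_real ((r\<^sup>2) ^ n) * (z / x) = 1" for n
  proof (cases n)
    case (Suc m)
    have "(r\<^sup>2) ^ n * norm z = x"
    proof -
      have "norm (of_real ((r\<^sup>2) ^ n) * (z / x)) = 1" using that by simp
      then show ?thesis using q by (simp add: norm_mult norm_divide norm_power field_simps)
    qed
    moreover have "(r\<^sup>2) ^ n * norm z \<le> r\<^sup>2 * norm z"
      using pow[of m] Suc by (intro mult_right_mono) auto
    moreover have "r\<^sup>2 * norm z < r\<^sup>2 * (1 / x)"
      using q assms by (intro mult_strict_left_mono) auto
    ultimately have "x < r\<^sup>2 * (1 / x)" by linarith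
    then have "x * x < r\<^sup>2" using q by (simp add: field_simps)
    moreover have "r\<^sup>2 < x * x" using rx by (simp add: power2_eq_square mult_strict_mono)
    ultimately show ?thesis by simp
  qed (use that q in \<open>auto simp: field_simps\<close>)
  moreover have "of_real ((r\<^sup>2) ^ n) * (r\<^sup>2 * x / z) \<noteq> 1" for n
  proof
    assume "of_real ((r\<^sup>2) ^ n) * (r\<^sup>2 * x / z) = 1"
    then have "norm (of_real ((r\<^sup>2) ^ n) * (r\<^sup>2 * x / z)) = 1" by simp
    then have "(r\<^sup>2) ^ Suc n * x = norm z"
      using q z by (simp add: norm_mult norm_divide norm_power field_simps)
    moreover have "(r\<^sup>2) ^ Suc n * x \<le> r\<^sup>2 * x"
      using q pow by (intro mult_right_mono) auto
    ultimately show False using assms q by simp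
  qed
  moreover have "qprod (r\<^sup>2) 1 = 0"
    using qprod_eq_0_iff[of "r\<^sup>2" 1] q by (auto intro: exI[of _ 0])
  ultimately show ?thesis
    using slit_map_denominator_nonzero[OF assms] q qprod_eq_0_iff[of "r\<^sup>2" "z / x"]
      qprod_eq_0_iff[of "r\<^sup>2" "r\<^sup>2 * x / z"]
    by (auto simp: slit_map_def)
qed

text \<open>Here conjugation sends z to 1 / z and carries the numerator to the denominator up to the
  factor (1 - 1/w) / (1 - w) = -1/w with w = zx, which comes from \<open>qprod_rec\<close>. Its
  modulus 1 / x cancels the leading constant x.\<close>

lemma norm_slit_map_outer:
  assumes "norm z = 1"
  shows "norm (slit_map r x z) = 1"
proof -
  let ?Q = "qprod (r\<^sup>2)"
  have z: "z \<noteq> 0" using assms by auto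
  have cz: "cnj z = 1 / z"
    using assms z complex_norm_square[of z] by (simp add: field_simps)
  have zx: "z * x \<noteq> 1"
    using assms q rx by (metis mult_1 norm_mult norm_of_real norm_one abs_of_pos less_irrefl)
  have "cnj (?Q (z / x)) = (1 - 1 / (z * x)) * ?Q (r\<^sup>2 / (z * x))"
    using q by (simp add: cnj_qprod cz qprod_rec[of "r\<^sup>2" "1 / (z * x)"])
  moreover have "cnj (?Q (r\<^sup>2 * x / z)) = ?Q (z * x) / (1 - z * x)"
    using q zx by (simp add: cnj_qprod cz qprod_rec[of "r\<^sup>2" "z * x"] field_simps)
  moreover have "(1 - 1 / w) * D * (N / (1 - w)) = - (N * D) / w"
    if "w \<noteq> 0" "w \<noteq> 1" for w D N :: complex
    using that by (simp add: divide_simps) (simp add: algebra_simps)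
  ultimately have "cnj (?Q (z / x) * ?Q (r\<^sup>2 * x / z))
      = - (?Q (z * x) * ?Q (r\<^sup>2 / (z * x))) / (z * x)"
    using zx z q unfolding complex_cnj_mult by simp
  then have "norm (cnj (?Q (z / x) * ?Q (r\<^sup>2 * x / z)))
      = norm (- (?Q (z * x) * ?Q (r\<^sup>2 / (z * x))) / (z * x))"
    by (rule arg_cong)
  then have "norm (?Q (z / x) * ?Q (r\<^sup>2 * x / z))
      = norm (?Q (z * x) * ?Q (r\<^sup>2 / (z * x))) / x"
    using assms q unfolding complex_mod_cnj norm_divide norm_minus_cancel
    by (simp add: norm_mult)
  then show ?thesis
    using slit_map_denominator_nonzero[of z] q rx assms
    unfolding slit_map_def norm_divide norm_mult[of "of_real x"] by simp
qed

text \<open>Here conjugation sends z to r^2 / z and exchanges the factors of numerator and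
  denominator exactly, so only the leading constant x remains.\<close>

lemma norm_slit_map_inner:
  assumes "norm z = r"
  shows "norm (slit_map r x z) = x"
proof -
  let ?Q = "qprod (r\<^sup>2)"
  have z: "z \<noteq> 0" using assms rx by auto
  have cz: "cnj z = r\<^sup>2 / z"
    using assms z complex_norm_square[of z] by (simp add: field_simps)
  have "cnj (?Q (z / x)) = ?Q (r\<^sup>2 / (z * x))"
    using q by (simp add: cnj_qprod cz)
  moreover have "cnj (?Q (r\<^sup>2 * x / z)) = ?Q (z * x)"
    using q z rx by (simp add: cnj_qprod cz mult.commute)
  ultimately have "norm (?Q (z / x) * ?Q (r\<^sup>2 * x / z)) = norm (?Q (z * x) * ?Q (r\<^sup>2 / (z * x)))"
    by (metis complex_mod_cnj norm_mult mult.commute)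
  then show ?thesis
    using slit_map_denominator_nonzero[of z] q rx assms
    unfolding slit_map_def norm_divide norm_mult[of "of_real x"] by simp
qed

text \<open>By \<open>qprod_rec\<close> the zero at x comes from the single linear factor 1 - z / x.
  Hence the map is (z - x) R(z) with R holomorphic near x, and the derivative at x is R(x), which is
  nonzero.\<close>

lemma deriv_slit_map_nonzero: "deriv (slit_map r x) x \<noteq> 0"
proof -
  let ?Q = "qprod (r\<^sup>2)"
  define S where "S = {z::complex. r\<^sup>2 / x < norm z \<and> norm z < 1 / x}"
  define R where "R = (\<lambda>z::complex. - (?Q (r\<^sup>2 * z / x) * ?Q (r\<^sup>2 * x / z)) / (?Q (z * x) * ?Q (r\<^sup>2 / (z * x))))"
  have "open S"
    unfolding S_def by (intro open_Collect_conj open_Collect_less continuous_intros)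
  have "r\<^sup>2 / x < x" "x < 1 / x" using q rx by linarith+
  then have "of_real x \<in> S" using q(5) by (simp add: S_def)
  have "z \<noteq> 0" if "r\<^sup>2 / x < norm z" for z :: complex
    using that q by (auto simp: field_simps)
  then have "R holomorphic_on S"
    unfolding R_def S_def using q slit_map_denominator_nonzero
    by (intro holomorphic_intros) auto
  then have "(R has_field_derivative deriv R x) (at x)"
    using \<open>open S\<close> \<open>of_real x \<in> S\<close> by (intro holomorphic_derivI)
  then have "((\<lambda>z::complex. (z - x) * R z) has_field_derivative R x) (at x)"
    by (auto intro!: derivative_eq_intros)
  moreover have "slit_map r x = (\<lambda>z::complex. (z - x) * R z)"
  proof
    fix z :: complex
    have "x * ?Q (z / x) = x * (1 - z / x) * ?Q (r\<^sup>2 * z / x)"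
      using q qprod_rec[of "r\<^sup>2" "z / x"] by simp
    also have "x * (1 - z / x) = - (z - x)"
      using q by (simp add: field_simps)
    finally have eq: "x * ?Q (z / x) = - (z - x) * ?Q (r\<^sup>2 * z / x)" .
    have "x * (?Q (z / x) * C) = (z - x) * (- (?Q (r\<^sup>2 * z / x) * C))" for C :: complex
      unfolding mult.assoc[symmetric] eq by (simp add: algebra_simps)
    then show "slit_map r x z = (z - x) * R z"
      unfolding slit_map_def R_def by simp
  qed
  ultimately have "deriv (slit_map r x) x = R x"
    by (simp add: DERIV_imp_deriv)
  moreover have "R x \<noteq> 0"
    using q \<open>of_real x \<in> S\<close> slit_map_denominator_nonzero[of x] qprod_nonzero[of "r\<^sup>2" "r\<^sup>2"]
    by (auto simp: R_def S_def norm_power)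
  ultimately show ?thesis by simp
qed

text \<open>For r^2 / x < |z| < x all four arguments of \<open>qprod\<close> lie in the unit disc,
  where \<open>qprod\<close> has a holomorphic logarithm. So the map is x exp(L) with L
  single-valued around |z| = r, and its logarithmic derivative has the primitive L.\<close>

lemma contour_integral_logderiv_slit_map:
  "contour_integral (circlepath 0 r) (\<lambda>z. deriv (slit_map r x) z / slit_map r x z) = 0"
proof -
  let ?Q = "qprod (r\<^sup>2)"
  have "?Q holomorphic_on ball 0 1"
    using holomorphic_qprod q by (blast intro: holomorphic_on_subset)
  then obtain l where l: "l holomorphic_on ball 0 1" "\<And>z. z \<in> ball 0 1 \<Longrightarrow> ?Q z = exp (l z)"
    using contractible_imp_holomorphic_log[OF _ convex_imp_contractible[OF convex_ball], of ?Q]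
      qprod_nonzero q by (metis mem_ball_0)
  define S where "S = {z::complex. r\<^sup>2 / x < norm z \<and> norm z < x}"
  define L where "L = (\<lambda>z::complex. l (z / x) + l (r\<^sup>2 * x / z) - l (z * x) - l (r\<^sup>2 / (z * x)))"
  have "open S"
    unfolding S_def by (intro open_Collect_conj open_Collect_less continuous_intros)
  have nz: "z \<noteq> 0" if "z \<in> S" for z
    using that q by (auto simp: S_def field_simps)
  have args: "z / x \<in> ball 0 1" "r\<^sup>2 * x / z \<in> ball 0 1" "z * x \<in> ball 0 1"
    "r\<^sup>2 / (z * x) \<in> ball 0 1" if "z \<in> S" for z :: complex
  proof -
    have z: "r\<^sup>2 / x < norm z" "norm z < x" "0 < norm z"
      using that nz[OF that] by (auto simp: S_def)
    have "norm z * x < 1 * 1" using z rx by (intro mult_strict_mono) auto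
    moreover have "r\<^sup>2 * x < norm z" using z q by linarith
    ultimately show "z / x \<in> ball 0 1" "r\<^sup>2 * x / z \<in> ball 0 1" "z * x \<in> ball 0 1"
      "r\<^sup>2 / (z * x) \<in> ball 0 1"
      using z q by (auto simp: norm_mult norm_divide norm_power field_simps)
  qed
  have l_comp: "(\<lambda>z. l (g z)) holomorphic_on S" if "g holomorphic_on S" "\<And>z. z \<in> S \<Longrightarrow> g z \<in> ball 0 1" for g
    using holomorphic_on_compose_gen[OF that(1) l(1)] image_subsetI[of S g, OF that(2)]
    by (simp add: o_def)
  have "0 \<notin> S" using nz by blast
  then have "L holomorphic_on S"
    unfolding L_def using args q
    by (intro holomorphic_on_add holomorphic_on_diff l_comp) (auto intro!: holomorphic_intros)
  then have L: "(L has_field_derivative deriv L z) (at z)" if "z \<in> S" for z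
    using that \<open>open S\<close> by (intro holomorphic_derivI)
  have eq: "slit_map r x z = x * exp (L z)" if "z \<in> S" for z
    unfolding slit_map_def L_def using args[OF that] by (simp add: l(2) exp_add exp_diff)
  have "deriv (slit_map r x) z / slit_map r x z = deriv L z" if "z \<in> S" for z
  proof -
    have "((\<lambda>z. x * exp (L z)) has_field_derivative x * (exp (L z) * deriv L z)) (at z)"
      using L[OF that] by (auto intro!: derivative_eq_intros)
    moreover have "eventually (\<lambda>z. slit_map r x z = x * exp (L z)) (nhds z)"
      using eq that \<open>open S\<close> eventually_nhds by blast
    ultimately have "(slit_map r x has_field_derivative x * (exp (L z) * deriv L z)) (at z)"
      by (subst DERIV_cong_ev[OF refl _ refl])
    then show ?thesis
      using eq[OF that] q by (simp add: DERIV_imp_deriv)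
  qed
  moreover have "sphere 0 r \<subseteq> S" using q rx by (auto simp: S_def)
  ultimately have "contour_integral (circlepath 0 r) (\<lambda>z. deriv (slit_map r x) z / slit_map r x z)
      = contour_integral (circlepath 0 r) (deriv L)"
    using rx by (intro contour_integral_eq) auto
  also have "(deriv L has_contour_integral L (pathfinish (circlepath 0 r)) - L (pathstart (circlepath 0 r)))
      (circlepath 0 r)"
    using L \<open>sphere 0 r \<subseteq> S\<close> rx
    by (intro contour_integral_primitive[of S]) (auto intro: has_field_derivative_at_within)
  then have "contour_integral (circlepath 0 r) (deriv L) = 0"
    by (intro contour_integral_unique) simp
  finally show ?thesis .
qed

end

subsection \<open>Counting zeros in an annulus\<close>

text \<open>The radial homotopy between the two circles stays in the closed annulus, so Cauchy's
  theorem applies.\<close>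

lemma contour_integral_circlepath_annulus_eq:
  assumes f: "f holomorphic_on S" and "open S"
    and sub: "{z. \<rho> \<le> norm z \<and> norm z \<le> \<sigma>} \<subseteq> S" and "0 < \<rho>" "\<rho> \<le> \<sigma>"
  shows "contour_integral (circlepath 0 \<rho>) f = contour_integral (circlepath 0 \<sigma>) f"
proof (rule Cauchy_theorem_homotopic_loops[OF _ \<open>open S\<close> f])
  show "homotopic_loops S (circlepath 0 \<rho>) (circlepath 0 \<sigma>)"
  proof (rule homotopic_loops_linear)
    fix t :: real
    show "closed_segment (circlepath 0 \<rho> t) (circlepath 0 \<sigma> t) \<subseteq> S"
    proof
      fix w assume "w \<in> closed_segment (circlepath 0 \<rho> t) (circlepath 0 \<sigma> t)"
      then obtain u where u: "0 \<le> u" "u \<le> 1"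
        and "w = (1 - u) *\<^sub>R circlepath 0 \<rho> t + u *\<^sub>R circlepath 0 \<sigma> t"
        by (auto simp: in_segment)
      then have "w = of_real ((1 - u) * \<rho> + u * \<sigma>) * exp (2 * of_real pi * \<i> * of_real t)"
        by (simp add: circlepath scaleR_conv_of_real algebra_simps)
      moreover have "norm (exp (2 * of_real pi * \<i> * of_real t)) = 1"
        by simp
      ultimately have "norm w = \<bar>(1 - u) * \<rho> + u * \<sigma>\<bar>"
        by (simp only: norm_mult norm_of_real mult_1_right)
      moreover have "(1 - u) * \<rho> + u * \<sigma> \<in> {\<rho>..\<sigma>}"
      proof -
        have "(1 - u) * \<rho> + u * \<sigma> = \<rho> + u * (\<sigma> - \<rho>)"
          by (simp add: algebra_simps)
        moreover have "0 \<le> u * (\<sigma> - \<rho>)" "u * (\<sigma> - \<rho>) \<le> \<sigma> - \<rho>"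
          using u \<open>\<rho> \<le> \<sigma>\<close> by (auto intro: mult_left_le_one_le)
        ultimately show ?thesis by simp
      qed
      ultimately show "w \<in> S"
        using sub \<open>0 < \<rho>\<close> by auto
    qed
  qed auto
qed auto

text \<open>The local factorisation at a zero of order n is made global by gluing: near
  \<open>a\<close> the cofactor is \<open>zor_poly\<close>, elsewhere it is h(w) / (w -
  a)^n.\<close>

lemma factor_out_zero:
  fixes h :: "complex \<Rightarrow> complex"
  assumes h: "h holomorphic_on S" "open S" "connected S" and a: "a \<in> S" "h a = 0"
    and nz: "\<exists>w\<in>S. h w \<noteq> 0"
  obtains n g where "0 < n" "g holomorphic_on S" "g a \<noteq> 0" "\<And>w. w \<in> S \<Longrightarrow> h w = (w - a) ^ n * g w"
proof -
  define n where "n = nat (zorder h a)"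
  define k where "k = zor_poly h a"
  obtain e where e: "0 < n" "0 < e" "cball a e \<subseteq> S" "k holomorphic_on cball a e"
    "\<And>w. w \<in> cball a e \<Longrightarrow> h w = k w * (w - a) ^ n \<and> k w \<noteq> 0"
    using zorder_exist_zero[OF h a(1) nz] a(2) unfolding n_def k_def by auto
  define g where "g = (\<lambda>w. if w = a then k a else h w / (w - a) ^ n)"
  have "g holomorphic_on ball a e"
  proof (rule holomorphic_transform[of k])
    show "k holomorphic_on ball a e"
      using e(4) by (rule holomorphic_on_subset) auto
  qed (use e(5) in \<open>auto simp: g_def\<close>)
  moreover have "g holomorphic_on S - {a}"
  proof (rule holomorphic_transform[of "\<lambda>w. h w / (w - a) ^ n"])
    show "(\<lambda>w. h w / (w - a) ^ n) holomorphic_on S - {a}"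
      using h(1) by (intro holomorphic_intros) (auto intro: holomorphic_on_subset)
  qed (auto simp: g_def)
  ultimately have "g holomorphic_on ball a e \<union> (S - {a})"
    using h(2) by (intro holomorphic_on_Un) auto
  moreover have "ball a e \<union> (S - {a}) = S"
    using e(2,3) a by auto
  ultimately show thesis
    using that[of n g] e a by (auto simp: g_def)
qed

text \<open>This is the argument principle for an annulus, by induction on the zero set: one zero is
  divided out with its full multiplicity, and the cofactor has the remaining zeros. The number n
  counts zeros with multiplicity, hence it is at least \<open>card Z\<close>, with equality when all
  zeros are simple.\<close>

lemma logderiv_circlepath_diff_zeros:
  fixes h :: "complex \<Rightarrow> complex"
  defines "J \<equiv> \<lambda>\<rho> h. contour_integral (circlepath 0 \<rho>) (\<lambda>z. deriv h z / h z)"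
  assumes "h holomorphic_on S" "open S" "connected S"
    and sub: "{z. \<rho> \<le> norm z \<and> norm z \<le> \<sigma>} \<subseteq> S" and \<rho>\<sigma>: "0 < \<rho>" "\<rho> < \<sigma>"
    and "finite Z" "{z. \<rho> \<le> norm z \<and> norm z \<le> \<sigma> \<and> h z = 0} = Z"
    and "\<And>z. z \<in> Z \<Longrightarrow> \<rho> < norm z \<and> norm z < \<sigma>"
  shows "\<exists>n\<ge>card Z. ((\<forall>z\<in>Z. deriv h z \<noteq> 0) \<longrightarrow> n = card Z) \<and> J \<sigma> h - J \<rho> h = 2 * of_real pi * \<i> * of_nat n"
  using \<open>finite Z\<close> assms(2) assms(9-)
proof (induction Z arbitrary: h rule: finite_induct)
  case empty
  define S' where "S' = S - h -` {0}"
  have "open (S \<inter> h -` (- {0}))"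
    using empty.prems(1) \<open>open S\<close> by (intro continuous_open_preimage holomorphic_on_imp_continuous_on) auto
  moreover have "S \<inter> h -` (- {0}) = S'" by (auto simp: S'_def)
  ultimately have "open S'" by simp
  have "(\<lambda>z. deriv h z / h z) holomorphic_on S'"
    using empty.prems(1) \<open>open S'\<close>
    by (intro holomorphic_intros holomorphic_deriv) (auto simp: S'_def intro: holomorphic_on_subset)
  then have "J \<rho> h = J \<sigma> h"
    unfolding J_def using \<rho>\<sigma> sub empty.prems(2) \<open>open S'\<close>
    by (intro contour_integral_circlepath_annulus_eq[where S = S']) (auto simp: S'_def)
  then show ?case by auto
next
  case (insert a Z)
  have a: "\<rho> < norm a" "norm a < \<sigma>" "h a = 0" "a \<in> S"
    using insert.prems sub by auto
  have circ_S: "z \<in> S" if "norm z = \<rho> \<or> norm z = \<sigma>" for z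
    using that \<rho>\<sigma> sub by auto
  have h_nz: "h z \<noteq> 0" if "norm z = \<rho> \<or> norm z = \<sigma>" for z
  proof
    assume "h z = 0"
    then have "z \<in> insert a Z"
      unfolding insert.prems(2)[symmetric] using that \<rho>\<sigma> by auto
    then show False
      using insert.prems(3) that by force
  qed
  \<comment> \<open>The zeros lie strictly between the circles, so a point of a boundary circle
    witnesses that h is not identically zero.\<close>
  have "\<exists>w\<in>S. h w \<noteq> 0"
    using circ_S[of "of_real \<rho>"] h_nz[of "of_real \<rho>"] \<rho>\<sigma> by auto
  then obtain m g where g: "0 < m" "g holomorphic_on S" "g a \<noteq> 0"
    and h_eq: "\<And>w. w \<in> S \<Longrightarrow> h w = (w - a) ^ m * g w"
    using factor_out_zero[OF insert.prems(1) \<open>open S\<close> \<open>connected S\<close> a(4,3)] by metis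
  have g_zeros: "{z. \<rho> \<le> norm z \<and> norm z \<le> \<sigma> \<and> g z = 0} = Z"
    using insert.prems(2) insert.hyps(2) h_eq sub g(1,3) by force
  then obtain n where n: "card Z \<le> n" "(\<forall>z\<in>Z. deriv g z \<noteq> 0) \<longrightarrow> n = card Z" "J \<sigma> g - J \<rho> g = 2 * of_real pi * \<i> * of_nat n"
    using insert.IH[OF g(2)] insert.prems(3) by auto
  have deriv_h: "deriv h z = of_nat m * (z - a) ^ (m - 1) * g z + (z - a) ^ m * deriv g z"
    if "z \<in> S" for z
  proof -
    have "(g has_field_derivative deriv g z) (at z)"
      using g(2) that \<open>open S\<close> by (intro holomorphic_derivI)
    then have "((\<lambda>w. (w - a) ^ m * g w) has_field_derivative
        of_nat m * (z - a) ^ (m - 1) * g z + (z - a) ^ m * deriv g z) (at z)"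
      by (auto intro!: derivative_eq_intros)
    moreover have "eventually (\<lambda>w. h w = (w - a) ^ m * g w) (nhds z)"
      using h_eq that \<open>open S\<close> eventually_nhds by blast
    ultimately have "(h has_field_derivative
        of_nat m * (z - a) ^ (m - 1) * g z + (z - a) ^ m * deriv g z) (at z)"
      by (subst DERIV_cong_ev[OF refl _ refl])
    then show ?thesis by (rule DERIV_imp_deriv)
  qed
  have J_eq: "J \<tau> h = of_nat m * contour_integral (circlepath 0 \<tau>) (\<lambda>z. 1 / (z - a)) + J \<tau> g"
    if "\<tau> = \<rho> \<or> \<tau> = \<sigma>" for \<tau>
  proof -
    have \<tau>: "0 < \<tau>" using that \<rho>\<sigma> by auto
    have za: "z \<noteq> a" and gz: "g z \<noteq> 0" and zS: "z \<in> S" if "norm z = \<tau>" for z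
      using that \<open>\<tau> = \<rho> \<or> \<tau> = \<sigma>\<close> a h_nz[of z] h_eq[of z] circ_S[of z] g(1) by (auto simp: power_0_left)
    \<comment> \<open>The common factor c stands for (z - a)^(m - 1).\<close>
    have quot: "(of_nat m * c * u + d * c * v) / (d * c * u) = of_nat m * (1 / d) + v / u"
      if "d \<noteq> 0" "c \<noteq> 0" "u \<noteq> 0" for c d u v :: complex
      using that by (simp add: field_simps)
    have "deriv h z / h z = of_nat m * (1 / (z - a)) + deriv g z / g z" if "norm z = \<tau>" for z
    proof -
      have "(z - a) ^ m = (z - a) * (z - a) ^ (m - 1)"
        using g(1) by (cases m) auto
      then show ?thesis
        using quot[of "z - a" "(z - a) ^ (m - 1)" "g z" "deriv g z"] za[OF that] gz[OF that]
        by (simp add: deriv_h[OF zS[OF that]] h_eq[OF zS[OF that]])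
    qed
    then have "J \<tau> h = contour_integral (circlepath 0 \<tau>) (\<lambda>z. of_nat m * (1 / (z - a)) + deriv g z / g z)"
      unfolding J_def using \<tau> by (intro contour_integral_eq) auto
    also have "\<dots> = contour_integral (circlepath 0 \<tau>) (\<lambda>z. of_nat m * (1 / (z - a))) + J \<tau> g"
      unfolding J_def
    proof (rule contour_integral_add)
      show "(\<lambda>z. of_nat m * (1 / (z - a))) contour_integrable_on circlepath 0 \<tau>"
        using \<tau> za by (intro contour_integrable_continuous_circlepath) (auto intro!: continuous_intros)
      have "continuous_on S g" "continuous_on S (deriv g)"
        using g(2) \<open>open S\<close> by (auto intro!: holomorphic_on_imp_continuous_on holomorphic_deriv)
      then show "(\<lambda>z. deriv g z / g z) contour_integrable_on circlepath 0 \<tau>"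
        using \<tau> gz zS by (intro contour_integrable_continuous_circlepath continuous_on_divide)
          (auto intro: continuous_on_subset)
    qed
    also have "contour_integral (circlepath 0 \<tau>) (\<lambda>z. of_nat m * (1 / (z - a)))
        = of_nat m * contour_integral (circlepath 0 \<tau>) (\<lambda>z. 1 / (z - a))"
      using \<tau> za by (intro contour_integral_lmul contour_integrable_continuous_circlepath)
        (auto intro!: continuous_intros)
    finally show ?thesis .
  qed
  \<comment> \<open>The outer circle winds once around \<open>a\<close> and the inner one not at
    all, so dividing out (z - a)^m changes the difference by m periods.\<close>
  have "contour_integral (circlepath 0 \<sigma>) (\<lambda>z. 1 / (z - a)) = 2 * of_real pi * \<i>"
    using winding_number_valid_path[of "circlepath 0 \<sigma>" a] winding_number_circlepath[of a 0 \<sigma>] a \<rho>\<sigma>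
    by (simp add: field_simps)
  moreover have "contour_integral (circlepath 0 \<rho>) (\<lambda>z. 1 / (z - a)) = 0"
  proof -
    have "winding_number (circlepath 0 \<rho>) a = 0"
      using a \<rho>\<sigma> by (intro winding_number_zero_outside[of _ "cball 0 \<rho>"]) auto
    then show ?thesis
      using winding_number_valid_path[of "circlepath 0 \<rho>" a] a \<rho>\<sigma> by simp
  qed
  ultimately have "J \<sigma> h - J \<rho> h = 2 * of_real pi * \<i> * of_nat (m + n)"
    using n(3) by (simp add: J_eq algebra_simps)
  moreover have "card (insert a Z) \<le> m + n"
    using n(1) g(1) insert.hyps by simp
  moreover have "m + n = card (insert a Z)" if simple: "\<forall>z\<in>insert a Z. deriv h z \<noteq> 0"
  proof -
    \<comment> \<open>For m >= 2 both terms of the product rule would vanish at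
      \<open>a\<close>.\<close>
    have "m = 1"
      using simple deriv_h[OF a(4)] g(1) by (cases "m - 1") (auto simp: power_0_left split: if_splits)
    moreover have "deriv g z \<noteq> 0" if "z \<in> Z" for z
    proof -
      have "z \<in> S" "g z = 0"
        using that g_zeros sub by auto
      then show ?thesis
        using simple that deriv_h[of z] by auto
    qed
    ultimately show ?thesis
      using n(2) insert.hyps by simp
  qed
  ultimately show ?case by blast
qed

section \<open>Winding numbers of image circles and injectivity of circular slit maps\<close>

text \<open>Substitution of v = F z. Written as a winding number, the integral is seen to be
  constant while w moves without crossing the image of the circle.\<close>

lemma contour_integral_logderiv_shift:
  assumes F: "F holomorphic_on S" "open S" and sub: "sphere 0 \<rho> \<subseteq> S" "0 < \<rho>"
    and w: "w \<notin> F ` sphere 0 \<rho>"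
  shows "contour_integral (circlepath 0 \<rho>) (\<lambda>z. deriv (\<lambda>z. F z - w) z / (F z - w))
    = 2 * of_real pi * \<i> * winding_number (F \<circ> circlepath 0 \<rho>) w"
proof -
  have image: "path_image (F \<circ> circlepath 0 \<rho>) = F ` sphere 0 \<rho>"
    using sub by (simp add: path_image_compose)
  have vp: "valid_path (F \<circ> circlepath 0 \<rho>)"
    using assms by (intro valid_path_compose_holomorphic[OF _ F]) auto
  have diff: "F field_differentiable at z" if "norm z = \<rho>" for z
    using F sub that by (intro holomorphic_on_imp_differentiable_at[OF F]) auto
  have "2 * of_real pi * \<i> * winding_number (F \<circ> circlepath 0 \<rho>) w
      = contour_integral (F \<circ> circlepath 0 \<rho>) (\<lambda>v. 1 / (v - w))"
    using winding_number_valid_path[OF vp] w image by simp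
  also have "\<dots> = contour_integral (circlepath 0 \<rho>) (\<lambda>z. deriv F z * (1 / (F z - w)))"
    using F sub by (intro contour_integral_comp_analyticW[of F S]) (auto simp: analytic_on_open)
  also have "\<dots> = contour_integral (circlepath 0 \<rho>) (\<lambda>z. deriv (\<lambda>z. F z - w) z / (F z - w))"
    using sub diff by (intro contour_integral_eq) auto
  finally show ?thesis by simp
qed

text \<open>The argument principle counts the preimages of w. The contribution of the outer circle
  is constant for |w| < 1, that of the inner circle is 0 off |w| = x, so each such w has exactly as
  many preimages as 0, namely one. Values with |w| = x are reached through openness.\<close>

lemma circular_slit_map:
  fixes F :: "complex \<Rightarrow> complex" and r x :: real
  assumes F: "F holomorphic_on S" "open S" "connected S"
    and sub: "{z. r \<le> norm z \<and> norm z \<le> 1} \<subseteq> S" and "0 < r" "r < 1" "0 < x" "x < 1"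
    and outer: "\<And>z. norm z = 1 \<Longrightarrow> norm (F z) = 1"
    and inner: "\<And>z. norm z = r \<Longrightarrow> norm (F z) = x"
    and inner0: "contour_integral (circlepath 0 r) (\<lambda>z. deriv F z / F z) = 0"
    and zero: "\<And>z. r \<le> norm z \<Longrightarrow> norm z \<le> 1 \<Longrightarrow> F z = 0 \<longleftrightarrow> z = c"
    and c: "r < norm c" "norm c < 1" "deriv F c \<noteq> 0"
  shows "inj_on F (annulus r)" "ball 0 x \<subseteq> F ` annulus r" "F ` annulus r \<subseteq> ball 0 1"
proof -
  define J where "J = (\<lambda>\<rho> w. contour_integral (circlepath 0 \<rho>)
    (\<lambda>z. deriv (\<lambda>z. F z - w) z / (F z - w)))"
  have annS: "annulus r \<subseteq> S" using sub by (auto simp: annulus_def)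
  have open_ann: "open (annulus r)"
    unfolding annulus_def by (intro open_Collect_conj open_Collect_less continuous_intros)
  \<comment> \<open>The moduli 1 and x on the two boundary circles differ.\<close>
  have nonconst: "\<not> (\<lambda>z. F z - w) constant_on S" for w
  proof
    assume "(\<lambda>z. F z - w) constant_on S"
    moreover have "of_real r \<in> S" "of_real 1 \<in> S"
      using sub \<open>0 < r\<close> \<open>r < 1\<close> by (auto simp del: of_real_1)
    ultimately have "F (of_real r) = F (of_real 1)"
      unfolding constant_on_def by (metis diff_add_cancel)
    then show False
      using outer[of "of_real 1"] inner[of "of_real r"] \<open>0 < r\<close> \<open>x < 1\<close> by simp
  qed
  have open_im: "open (F ` U)" if "open U" "U \<subseteq> annulus r" for U
    using that annS nonconst[of 0] by (intro open_mapping_thm[OF F]) auto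

  show "F ` annulus r \<subseteq> ball 0 1"
  proof -
    have "closed {z::complex. r \<le> norm z \<and> norm z \<le> 1}"
      by (intro closed_Collect_conj closed_Collect_le continuous_intros)
    then have cl: "closure (annulus r) \<subseteq> {z. r \<le> norm z \<and> norm z \<le> 1}"
      by (intro closure_minimal) (auto simp: annulus_def)
    have "norm (F z) \<le> 1" if "z \<in> annulus r" for z
    proof (rule maximum_modulus_frontier[OF _ _ _ _ that])
      show "F holomorphic_on interior (annulus r)"
        using F(1) annS interior_subset by (meson holomorphic_on_subset order_trans)
      show "continuous_on (closure (annulus r)) F"
        using F(1) cl sub by (meson continuous_on_subset holomorphic_on_imp_continuous_on)
      show "bounded (annulus r)"
        by (rule bounded_subset[of "ball 0 1"]) (auto simp: annulus_def)
      fix z assume "z \<in> frontier (annulus r)"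
      then have "norm z = r \<or> norm z = 1"
        using cl open_ann unfolding frontier_def interior_open[OF open_ann]
        by (force simp: annulus_def)
      then show "norm (F z) \<le> 1" using outer inner \<open>x < 1\<close> by auto
    qed
    \<comment> \<open>The maximum principle gives only |F| <= 1; strictness follows because the
      image is open.\<close>
    then have "F ` annulus r \<subseteq> interior (cball 0 1)"
      by (intro interior_maximal open_im open_ann) auto
    then show ?thesis by simp
  qed

  have J_outer: "J 1 w = J 1 0" if "norm w < 1" for w
  proof -
    have "winding_number (F \<circ> circlepath 0 1) constant_on ball 0 1"
    proof (rule winding_number_constant)
      have "valid_path (F \<circ> circlepath 0 1)"
        using sub \<open>r < 1\<close> by (intro valid_path_compose_holomorphic[OF _ F(1,2)]) auto
      then show "path (F \<circ> circlepath 0 1)" by (rule valid_path_imp_path)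
    qed (use outer in \<open>auto simp: path_image_compose pathfinish_compose pathstart_compose\<close>)
    then have "winding_number (F \<circ> circlepath 0 1) w = winding_number (F \<circ> circlepath 0 1) 0"
      using that unfolding constant_on_def by auto
    moreover have "v \<notin> F ` sphere 0 1" if "norm v < 1" for v
      using outer that by force
    ultimately show ?thesis
      using that sub \<open>r < 1\<close> unfolding J_def
      by (subst (1 2) contour_integral_logderiv_shift[OF F(1,2)]) auto
  qed
  \<comment> \<open>The image of |z| = r lies on |w| = x. Inside that circle the winding number
    equals its value at 0, which vanishes by \<open>inner0\<close>; outside it vanishes because the
    curve stays in the disc.\<close>
  have J_inner: "J r w = 0" if "norm w \<noteq> x" for w
  proof -
    have path: "path (F \<circ> circlepath 0 r)"
      using sub \<open>0 < r\<close> \<open>r < 1\<close>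
      by (intro valid_path_imp_path valid_path_compose_holomorphic[OF _ F(1,2)]) auto
    have avoid: "v \<notin> F ` sphere 0 r" if "norm v \<noteq> x" for v
      using inner that by force
    have shift: "J r v = 2 * of_real pi * \<i> * winding_number (F \<circ> circlepath 0 r) v" if "norm v \<noteq> x" for v
      unfolding J_def using sub \<open>0 < r\<close> \<open>r < 1\<close> avoid[OF that]
      by (intro contour_integral_logderiv_shift[OF F(1,2)]) auto
    show ?thesis
    proof (cases "norm w < x")
      case True
      have "winding_number (F \<circ> circlepath 0 r) constant_on ball 0 x"
        by (rule winding_number_constant[OF path])
          (use inner \<open>0 < r\<close> in \<open>auto simp: path_image_compose pathfinish_compose pathstart_compose\<close>)
      then have "winding_number (F \<circ> circlepath 0 r) w = winding_number (F \<circ> circlepath 0 r) 0"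
        using True \<open>0 < x\<close> unfolding constant_on_def by auto
      moreover have "J r 0 = 0"
        using inner0 by (simp add: J_def)
      ultimately show ?thesis
        using shift[of 0] shift[OF that] \<open>0 < x\<close> by simp
    next
      case False
      have "winding_number (F \<circ> circlepath 0 r) w = 0"
        by (rule winding_number_zero_outside[OF path convex_cball[of 0 x]])
          (use False that inner \<open>0 < r\<close> in
            \<open>auto simp: path_image_compose pathfinish_compose pathstart_compose\<close>)
      then show ?thesis using shift[OF that] by simp
    qed
  qed

  have count: "\<exists>n\<ge>card {z\<in>annulus r. F z = w}.
      ((\<forall>z\<in>annulus r. F z = w \<longrightarrow> deriv F z \<noteq> 0) \<longrightarrow> n = card {z\<in>annulus r. F z = w}) \<and>
      J 1 0 = 2 * of_real pi * \<i> * of_nat n \<and> finite {z\<in>annulus r. F z = w}"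
    if w: "norm w < 1" "norm w \<noteq> x" for w
  proof -
    define Z where "Z = {z\<in>annulus r. F z = w}"
    have Z: "{z. r \<le> norm z \<and> norm z \<le> 1 \<and> F z - w = 0} = Z"
      using outer inner w unfolding Z_def annulus_def by (force simp: le_less)
    have holo: "(\<lambda>z. F z - w) holomorphic_on S"
      using F(1) by (intro holomorphic_intros)
    have "compact {z::complex. r \<le> norm z \<and> norm z \<le> 1}"
      unfolding compact_eq_bounded_closed
      by (intro conjI bounded_subset[OF bounded_cball[of 0 1]] closed_Collect_conj closed_Collect_le
          continuous_intros) auto
    then have "finite {z\<in>{z. r \<le> norm z \<and> norm z \<le> 1}. F z - w = 0}"
      using sub nonconst by (intro holomorphic_compact_finite_zeros[OF holo F(2,3)]) auto
    then have fin: "finite Z" using Z by simp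
    have d: "deriv (\<lambda>z. F z - w) z = deriv F z" if "z \<in> Z" for z
    proof -
      have "F field_differentiable at z"
        using that annS by (intro holomorphic_on_imp_differentiable_at[OF F(1,2)]) (auto simp: Z_def)
      then show ?thesis by simp
    qed
    have "\<exists>n\<ge>card Z. ((\<forall>z\<in>Z. deriv (\<lambda>z. F z - w) z \<noteq> 0) \<longrightarrow> n = card Z) \<and>
        J 1 w - J r w = 2 * of_real pi * \<i> * of_nat n"
      unfolding J_def
      by (rule logderiv_circlepath_diff_zeros[OF holo F(2,3) sub \<open>0 < r\<close> \<open>r < 1\<close> fin Z])
        (auto simp: Z_def annulus_def)
    then show ?thesis
      using fin d J_outer[OF w(1)] J_inner[OF w(2)] by (auto simp: Z_def)
  qed
  have "{z\<in>annulus r. F z = 0} = {c}"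
    using c zero by (force simp: annulus_def)
  with count[of 0] c \<open>0 < x\<close> have J1: "J 1 0 = 2 * of_real pi * \<i>" by auto
  have unique: "card {z\<in>annulus r. F z = w} \<le> 1" "finite {z\<in>annulus r. F z = w}"
    "{z\<in>annulus r. F z = w} \<noteq> {}"
    if w: "norm w < 1" "norm w \<noteq> x" for w
  proof -
    obtain n where "card {z\<in>annulus r. F z = w} \<le> n" "finite {z\<in>annulus r. F z = w}"
      "J 1 0 = 2 * of_real pi * \<i> * of_nat n"
      "(\<forall>z\<in>annulus r. F z = w \<longrightarrow> deriv F z \<noteq> 0) \<longrightarrow> n = card {z\<in>annulus r. F z = w}"
      using count[OF w] by auto
    \<comment> \<open>An empty preimage would satisfy the simplicity condition vacuously and give n
      = 0, so n = 1 also yields surjectivity onto these values.\<close>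
    moreover from this J1 have "n = 1" by simp
    ultimately show "card {z\<in>annulus r. F z = w} \<le> 1" "finite {z\<in>annulus r. F z = w}"
      "{z\<in>annulus r. F z = w} \<noteq> {}" by (auto simp del: Collect_empty_eq)
  qed
  show "ball 0 x \<subseteq> F ` annulus r"
  proof
    fix w :: complex assume "w \<in> ball 0 x"
    then show "w \<in> F ` annulus r" using unique(3)[of w] \<open>x < 1\<close> by auto
  qed
  show "inj_on F (annulus r)"
  proof (rule inj_onI, rule ccontr)
    fix a b assume ab: "a \<in> annulus r" "b \<in> annulus r" "F a = F b" "a \<noteq> b"
    obtain U V where UV: "open U" "open V" "a \<in> U" "b \<in> V" "U \<inter> V = {}"
      using hausdorff[OF \<open>a \<noteq> b\<close>] by metis
    \<comment> \<open>G is an open set of values attained at least twice. It contains a value off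
      the circle of radius x, contradicting \<open>unique\<close>.\<close>
    define G where "G = F ` (U \<inter> annulus r) \<inter> F ` (V \<inter> annulus r)"
    have "open G"
      unfolding G_def using UV open_ann by (intro open_Int open_im) auto
    have "F a \<in> G"
      unfolding G_def using ab UV by (metis IntI imageI)
    with \<open>open G\<close> obtain e where e: "0 < e" "ball (F a) e \<subseteq> G"
      unfolding open_contains_ball by blast
    have "\<exists>w\<in>G. norm w \<noteq> x"
    proof (cases "norm (F a) = x")
      case True
      \<comment> \<open>Moving \<open>F a\<close> radially outward by e / 2 leaves the circle but
        not the e-ball.\<close>
      define w where "w = of_real (1 + e / (2 * x)) * F a"
      have "norm w = x + e / 2"
        unfolding w_def norm_mult norm_of_real using True e \<open>0 < x\<close> by (simp add: field_simps)
      moreover have "dist (F a) w = e / 2"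
      proof -
        have "dist (F a) w = norm (of_real (e / (2 * x)) * F a)"
          by (simp add: w_def dist_norm algebra_simps norm_minus_commute)
        then show ?thesis
          unfolding norm_mult norm_of_real using True e \<open>0 < x\<close> by simp
      qed
      ultimately show ?thesis
        using e by (intro bexI[of _ w]) auto
    qed (use \<open>F a \<in> G\<close> in auto)
    then obtain w where w: "w \<in> G" "norm w \<noteq> x" by auto
    then obtain a' b' where a'b': "a' \<in> U" "b' \<in> V" "a' \<in> annulus r" "b' \<in> annulus r" "F a' = w" "F b' = w"
      unfolding G_def by auto
    then have "norm w < 1"
      using \<open>F ` annulus r \<subseteq> ball 0 1\<close> by auto
    moreover have "a' \<noteq> b'" using a'b' UV by auto
    then have "card {a', b'} = 2" by simp
    moreover have "card {a', b'} \<le> card {z\<in>annulus r. F z = w}"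
      using unique(2)[OF \<open>norm w < 1\<close> w(2)] a'b' by (intro card_mono) auto
    ultimately show False
      using unique(1)[OF \<open>norm w < 1\<close> w(2)] by simp
  qed
qed

subsection \<open>Logarithmic means over circles\<close>

text \<open>Pull \<open>k\<close> back to a strip by \<open>exp\<close>, where \<open>k \<circ> exp = exp \<circ> G\<close>, and let \<open>P' = G\<close>. Since \<open>G\<close> grows
  by \<open>2 \<pi> \<i> m\<close> along a period, the mean of \<open>ln |k|\<close> over \<open>|z| = \<rho>\<close>, which is an increment of
  \<open>Im P\<close>, is affine in \<open>ln \<rho>\<close>; the mean value theorem turns it into an attained value.\<close>

lemma log_norm_mean_annulus:
  assumes k: "k holomorphic_on annulus r" "\<And>z. z \<in> annulus r \<Longrightarrow> k z \<noteq> 0" and r: "0 < r" "r < 1"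
  obtains c :: real and m :: int where
    "\<And>\<rho>. r < \<rho> \<Longrightarrow> \<rho> < 1 \<Longrightarrow> \<exists>z. norm z = \<rho> \<and> ln (norm (k z)) = c + m * ln \<rho>"
proof -
  define T where "T = {w. ln r < Re w} \<inter> {w. Re w < 0}"
  define p where "p = 2 * of_real pi * \<i>"
  have T: "open T" "convex T"
    unfolding T_def by (auto intro!: convex_Int open_Int convex_halfspace_Re_gt convex_halfspace_Re_lt
      open_halfspace_Re_gt open_halfspace_Re_lt)
  have exp_T: "exp w \<in> annulus r" if "w \<in> T" for w
  proof -
    have "exp (ln r) < exp (Re w)" using that by (subst exp_less_cancel_iff) (auto simp: T_def)
    then show ?thesis using that r by (auto simp: T_def annulus_def)
  qed
  have shift_T: "w + p \<in> T" if "w \<in> T" for w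
    using that by (auto simp: T_def p_def)
  have "(\<lambda>w. k (exp w)) holomorphic_on T"
    using holomorphic_on_compose_gen[OF holomorphic_on_exp k(1), of T] exp_T by (auto simp: o_def)
  then obtain G where G: "G holomorphic_on T" "\<And>w. w \<in> T \<Longrightarrow> k (exp w) = exp (G w)"
    using contractible_imp_holomorphic_log[OF _ convex_imp_contractible[OF T(2)]] k(2) exp_T by metis
  obtain P where P: "\<And>w. w \<in> T \<Longrightarrow> (P has_field_derivative G w) (at w)"
    using holomorphic_convex_primitive'[OF T(2,1) G(1)] at_within_open[OF _ T(1)] by metis
  have period: "\<exists>n::int. G (w + p) - G w = of_int n * p" if "w \<in> T" for w
  proof -
    have "exp (G (w + p)) = exp (G w)"
      using G(2)[OF that] G(2)[OF shift_T[OF that]] by (simp add: p_def exp_add)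
    then show ?thesis
      unfolding exp_eq p_def by (auto simp: algebra_simps)
  qed
  \<comment> \<open>A continuous function on a connected set with values in the integer multiples of
    p is constant, since distinct multiples are at distance at least 2 pi.\<close>
  have "(\<lambda>w. G (w + p) - G w) constant_on T"
  proof (rule continuous_discrete_range_constant)
    show "connected T" using T(2) by (rule convex_connected)
    have "continuous_on T G" using G(1) by (rule holomorphic_on_imp_continuous_on)
    moreover have "continuous_on T (\<lambda>w. G (w + p))"
      by (rule continuous_on_compose2[OF \<open>continuous_on T G\<close>]) (auto intro!: continuous_intros shift_T)
    ultimately show "continuous_on T (\<lambda>w. G (w + p) - G w)" by (intro continuous_on_diff)
    fix v assume "v \<in> T"
    have "1 \<le> norm (G (w + p) - G w - (G (v + p) - G v))"
      if "w \<in> T" and ne: "G (w + p) - G w \<noteq> G (v + p) - G v" for w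
    proof -
      obtain a b :: int where ab: "G (w + p) - G w = of_int a * p" "G (v + p) - G v = of_int b * p"
        using period \<open>v \<in> T\<close> \<open>w \<in> T\<close> by metis
      then have "a \<noteq> b" using ne by auto
      then have "1 \<le> \<bar>real_of_int (a - b)\<bar>" by linarith
      then have "1 * 1 \<le> \<bar>real_of_int (a - b)\<bar> * (2 * pi)"
        using pi_gt3 by (intro mult_mono) auto
      also have "\<dots> = norm (of_int (a - b) * p)"
        unfolding norm_mult norm_of_int p_def by simp
      finally show ?thesis
        unfolding ab by (simp add: algebra_simps)
    qed
    then show "\<exists>e>0. \<forall>w. w \<in> T \<and> G (w + p) - G w \<noteq> G (v + p) - G v \<longrightarrow>
        e \<le> norm (G (w + p) - G w - (G (v + p) - G v))"
      by (intro exI[of _ 1]) auto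
  qed
  then obtain b where b: "\<And>w. w \<in> T \<Longrightarrow> G (w + p) - G w = b"
    unfolding constant_on_def by blast
  have "T \<noteq> {}"
  proof -
    have "of_real (ln r / 2) \<in> T" using r by (auto simp: T_def)
    then show ?thesis by blast
  qed
  then obtain m :: int where m: "b = of_int m * p" using period b by blast
  \<comment> \<open>The increment of P over a period has derivative b, so it is an affine function
    of w.\<close>
  have "(\<lambda>w. P (w + p) - P w - b * w) constant_on T"
  proof (rule has_field_derivative_0_imp_constant_on[OF _ convex_connected[OF T(2)] T(1)])
    fix w assume w: "w \<in> T"
    have "((\<lambda>w. P (w + p)) has_field_derivative G (w + p)) (at w)"
      using P[OF shift_T[OF w]] by (simp add: DERIV_shift)
    then have "((\<lambda>w. P (w + p) - P w - b * w) has_field_derivative G (w + p) - G w - b * 1) (at w)"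
      by (intro DERIV_diff DERIV_cmult DERIV_ident P w)
    then show "((\<lambda>w. P (w + p) - P w - b * w) has_field_derivative 0) (at w)"
      using b[OF w] by simp
  qed
  then obtain C where C: "\<And>w. w \<in> T \<Longrightarrow> P (w + p) - P w - b * w = C"
    unfolding constant_on_def by blast
  show thesis
  proof (rule that[of "Im C / (2 * pi)" m])
    fix \<rho> :: real assume \<rho>: "r < \<rho>" "\<rho> < 1"
    define s where "s = ln \<rho>"
    define \<gamma> where "\<gamma> = (\<lambda>y::real. of_real s + of_real y * \<i>)"
    have \<gamma>_T: "\<gamma> y \<in> T" for y
      using \<rho> r by (auto simp: \<gamma>_def T_def s_def)
    \<comment> \<open>Along a vertical line P has derivative i G, whose imaginary part is Re G = ln
      |k|. The increment of Im P over length 2 pi is therefore 2 pi times the logarithmic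
      mean.\<close>
    have "((\<lambda>y. Im (P (\<gamma> y))) has_real_derivative Re (G (\<gamma> y))) (at y)" for y
    proof -
      have "(\<gamma> has_vector_derivative \<i>) (at y)"
        unfolding \<gamma>_def by (auto intro!: derivative_eq_intros simp: has_vector_derivative_def
            scaleR_conv_of_real)
      then have "((P \<circ> \<gamma>) has_vector_derivative \<i> * G (\<gamma> y)) (at y)"
        using P[OF \<gamma>_T] by (rule field_vector_diff_chain_at)
      from bounded_linear.has_vector_derivative[OF bounded_linear_Im this] show ?thesis
        by (simp add: o_def has_real_derivative_iff_has_vector_derivative)
    qed
    then obtain y where y: "Im (P (\<gamma> (2 * pi))) - Im (P (\<gamma> 0)) = (2 * pi - 0) * Re (G (\<gamma> y))"
      using MVT2[of 0 "2 * pi" "\<lambda>y. Im (P (\<gamma> y))" "\<lambda>y. Re (G (\<gamma> y))"] pi_gt_zero by auto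
    have "\<gamma> (2 * pi) = \<gamma> 0 + p" by (simp add: \<gamma>_def p_def)
    then have "P (\<gamma> (2 * pi)) - P (\<gamma> 0) = C + b * of_real s"
      using C[OF \<gamma>_T[of 0]] by (simp add: \<gamma>_def algebra_simps)
    then have "Im (P (\<gamma> (2 * pi))) - Im (P (\<gamma> 0)) = Im C + 2 * pi * m * s"
      unfolding minus_complex.sel(2)[symmetric] by (simp add: m p_def)
    then have "Re (G (\<gamma> y)) = Im C / (2 * pi) + m * s"
      using y by (simp add: field_simps)
    moreover have "norm (k (exp (\<gamma> y))) = exp (Re (G (\<gamma> y)))"
      using G(2)[OF \<gamma>_T] by simp
    moreover have "norm (exp (\<gamma> y)) = \<rho>"
      using \<rho> r by (simp add: \<gamma>_def s_def)
    ultimately show "\<exists>z. norm z = \<rho> \<and> ln (norm (k z)) = Im C / (2 * pi) + m * ln \<rho>"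
      by (intro exI[of _ "exp (\<gamma> y)"]) (simp add: s_def)
  qed
qed

subsection \<open>The squeezing function of the annulus\<close>

text \<open>Polar coordinates exhibit the set as a continuous image of a product of an interval with
  the line.\<close>

lemma connected_annulus_norm: "connected {z::complex. a < norm z \<and> norm z < b}" if "0 \<le> a"
proof -
  have "{z::complex. a < norm z \<and> norm z < b} = (\<lambda>(s, t). s *\<^sub>R cis t) ` ({a<..<b} \<times> UNIV)"
  proof (intro equalityI subsetI)
    fix z :: complex assume "z \<in> {z. a < norm z \<and> norm z < b}"
    then show "z \<in> (\<lambda>(s, t). s *\<^sub>R cis t) ` ({a<..<b} \<times> UNIV)"
      by (intro image_eqI[of _ _ "(norm z, Arg z)"])
        (auto simp: scaleR_conv_of_real rcis_cmod_Arg[unfolded rcis_def])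
  qed (use that in auto)
  moreover have "connected ({a<..<b} \<times> (UNIV :: real set))"
    by (intro connected_Times) auto
  ultimately show ?thesis
    by (auto intro!: connected_continuous_image continuous_intros simp: case_prod_unfold)
qed

lemma slit_map_embedding:
  assumes "0 < r" "r < x" "x < 1"
  shows "slit_map r x \<in> disc_embeddings (annulus r) x" "ball 0 x \<subseteq> slit_map r x ` annulus r"
proof -
  define S where "S = {z::complex. r\<^sup>2 / x < norm z \<and> norm z < 1 / x}"
  have "r\<^sup>2 / x < r" "1 < 1 / x" using assms by (auto simp: power2_eq_square field_simps)
  then have sub: "{z. r \<le> norm z \<and> norm z \<le> 1} \<subseteq> S" by (auto simp: S_def)
  have F: "slit_map r x holomorphic_on S"
    unfolding S_def by (rule holomorphic_slit_map[OF assms])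
  have S: "open S" "connected S"
    unfolding S_def using assms
    by (auto intro!: connected_annulus_norm open_Collect_conj open_Collect_less continuous_intros)
  have zero: "slit_map r x z = 0 \<longleftrightarrow> z = of_real x" if "r \<le> norm z" "norm z \<le> 1" for z
    using that sub by (intro slit_map_eq_0_iff[OF assms]) (auto simp: S_def)
  have slit: "inj_on (slit_map r x) (annulus r)" "ball 0 x \<subseteq> slit_map r x ` annulus r"
    "slit_map r x ` annulus r \<subseteq> ball 0 1"
    by (rule circular_slit_map[OF F S sub, where c = "of_real x" and x = x];
      use assms in \<open>simp add: norm_slit_map_outer norm_slit_map_inner zero
        contour_integral_logderiv_slit_map deriv_slit_map_nonzero\<close>)+
  then show "ball 0 x \<subseteq> slit_map r x ` annulus r" by simp
  have "annulus r \<subseteq> S" using sub by (auto simp: annulus_def)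
  then show "slit_map r x \<in> disc_embeddings (annulus r) x"
    unfolding disc_embeddings_def using slit F assms zero[of "of_real x"]
    by (auto intro: holomorphic_on_subset)
qed

section \<open>Boundary behaviour of the slit map and of a general embedding\<close>

text \<open>By uniform continuity on the compact annulus, \<open>\<phi>\<close> at z is close to its
  value at the radial projection of z to the circle, at distance equal to the difference of the
  radii.\<close>

lemma near_circle:
  fixes \<phi> :: "complex \<Rightarrow> real"
  assumes \<phi>: "continuous_on {z. a \<le> norm z \<and> norm z \<le> b} \<phi>" and "0 < a"
    and \<rho>: "a \<le> \<rho>" "\<rho> \<le> b" "\<And>z::complex. norm z = \<rho> \<Longrightarrow> \<phi> z = v" and "0 < e"
  obtains d where "0 < d"
    "\<And>z::complex. a \<le> norm z \<Longrightarrow> norm z \<le> b \<Longrightarrow> \<bar>norm z - \<rho>\<bar> < d \<Longrightarrow> \<bar>\<phi> z - v\<bar> < e"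
proof -
  define K where "K = {z::complex. a \<le> norm z \<and> norm z \<le> b}"
  have "compact K"
    unfolding K_def compact_eq_bounded_closed
    by (intro conjI bounded_subset[OF bounded_cball[of 0 b]] closed_Collect_conj closed_Collect_le
        continuous_intros) auto
  then have "uniformly_continuous_on K \<phi>"
    using \<phi> unfolding K_def by (intro compact_uniformly_continuous)
  then obtain d where d: "0 < d" "\<And>z w. z \<in> K \<Longrightarrow> w \<in> K \<Longrightarrow> dist w z < d \<Longrightarrow> dist (\<phi> w) (\<phi> z) < e"
    using \<open>0 < e\<close> unfolding uniformly_continuous_on_def by metis
  show thesis
  proof (rule that[OF d(1)])
    fix z :: complex assume z: "a \<le> norm z" "norm z \<le> b" "\<bar>norm z - \<rho>\<bar> < d"
    define w where "w = of_real (\<rho> / norm z) * z"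
    have "0 < norm z" using z \<open>0 < a\<close> by linarith
    then have "norm w = \<rho>"
      unfolding w_def norm_mult norm_of_real using \<rho> \<open>0 < a\<close> by simp
    have "z - w = of_real (1 - \<rho> / norm z) * z"
      by (simp add: w_def algebra_simps)
    then have "norm (z - w) = \<bar>1 - \<rho> / norm z\<bar> * \<bar>norm z\<bar>"
      by (simp only: norm_mult norm_of_real abs_norm_cancel)
    also have "\<dots> = \<bar>norm z - \<rho>\<bar>"
      unfolding abs_mult[symmetric] using \<open>0 < norm z\<close> by (simp add: algebra_simps)
    finally have "dist z w < d" using z by (simp add: dist_norm)
    then have "dist (\<phi> z) (\<phi> w) < e"
      using z \<rho> \<open>norm w = \<rho>\<close> by (intro d(2)) (auto simp: K_def)
    then show "\<bar>\<phi> z - v\<bar> < e" using \<rho>(3)[OF \<open>norm w = \<rho>\<close>] by (simp add: dist_real_def)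
  qed
qed

text \<open>An embedding need not extend continuously to the boundary. However, the preimage K of
  the closed disc of radius s < t is compact in the annulus, hence stays away from both boundary
  circles, and off K the modulus exceeds s.\<close>

lemma embedding_near_boundary:
  assumes f: "f holomorphic_on annulus r" "inj_on f (annulus r)"
    and t: "ball 0 t \<subseteq> f ` annulus r" "s < t" and "r < 1"
  obtains d where "0 < d"
    "\<And>z. z \<in> annulus r \<Longrightarrow> norm z < r + d \<or> 1 - d < norm z \<Longrightarrow> s < norm (f z)"
proof -
  have open_ann: "open (annulus r)"
    unfolding annulus_def by (intro open_Collect_conj open_Collect_less continuous_intros)
  obtain g where g: "g holomorphic_on f ` annulus r" "\<And>z. z \<in> annulus r \<Longrightarrow> g (f z) = z"
    using holomorphic_has_inverse[OF f(1) open_ann f(2)] by metis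
  define K where "K = g ` cball 0 s"
  have sub: "cball 0 s \<subseteq> f ` annulus r"
    using t by force
  then have "compact K"
    unfolding K_def using g(1)
    by (intro compact_continuous_image) (auto intro: holomorphic_on_imp_continuous_on holomorphic_on_subset)
  have "K \<subseteq> annulus r"
    unfolding K_def using sub g(2) by force
  have in_K: "z \<in> K" if "z \<in> annulus r" "\<not> s < norm (f z)" for z
    unfolding K_def using that g(2)[OF that(1)] by (intro image_eqI[of _ _ "f z"]) auto
  show thesis
  proof (cases "K = {}")
    \<comment> \<open>K is empty when s is negative; then any positive d serves.\<close>
    case True
    then show ?thesis using in_K by (intro that[of 1]) auto
  next
    case False
    obtain u v where uv: "u \<in> K" "\<And>z. z \<in> K \<Longrightarrow> norm u \<le> norm z"
      "v \<in> K" "\<And>z. z \<in> K \<Longrightarrow> norm z \<le> norm v"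
      using continuous_attains_inf[OF \<open>compact K\<close> False continuous_on_norm_id]
        continuous_attains_sup[OF \<open>compact K\<close> False continuous_on_norm_id] by metis
    then have "r < norm u" "norm v < 1"
      using \<open>K \<subseteq> annulus r\<close> by (auto simp: annulus_def)
    show ?thesis
    proof (rule that[of "min (norm u - r) (1 - norm v)"])
      show "0 < min (norm u - r) (1 - norm v)"
        using \<open>r < norm u\<close> \<open>norm v < 1\<close> by simp
      fix z assume z: "z \<in> annulus r"
        "norm z < r + min (norm u - r) (1 - norm v) \<or> 1 - min (norm u - r) (1 - norm v) < norm z"
      show "s < norm (f z)"
      proof (rule ccontr)
        assume "\<not> s < norm (f z)"
        then have "norm u \<le> norm z" "norm z \<le> norm v"
          using in_K[OF z(1)] uv by auto
        then show False using z(2) by linarith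
      qed
    qed
  qed
qed

text \<open>The logarithmic means of f / F near the two boundary circles force s <= x or s x <= r in
  the limit, for s between x and t. The hypothesis \<open>sqrt r \<le> x\<close> enters as r <= x^2,
  which rules out the second alternative.\<close>

lemma squeezing_upper_bound:
  assumes r: "0 < r" and x: "sqrt r \<le> x" "x < 1"
    and f: "f \<in> disc_embeddings (annulus r) x" and t: "ball 0 t \<subseteq> f ` annulus r"
  shows "t \<le> x"
proof (rule ccontr)
  assume "\<not> t \<le> x"
  then obtain s where s: "x < s" "s < t" using dense[of x t] by auto
  define A where "A = annulus r"
  define F where "F = slit_map r x"
  have "0 < x" using r x by (meson less_le_trans real_sqrt_gt_zero)
  have "sqrt r * sqrt r \<le> x * x" using r x \<open>0 < x\<close> by (intro mult_mono) auto
  then have "r \<le> x * x" using r by simp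
  moreover have "x * x < 1 * x" using x \<open>0 < x\<close> by (intro mult_strict_right_mono) auto
  ultimately have rx: "0 < r" "r < x" "x < 1" using r x by auto
  have open_A: "open A"
    unfolding A_def annulus_def by (intro open_Collect_conj open_Collect_less continuous_intros)
  have xA: "of_real x \<in> A" using rx by (auto simp: A_def annulus_def)
  have F: "F holomorphic_on A" "inj_on F A" "F ` A \<subseteq> ball 0 1" "F x = 0"
    using slit_map_embedding(1)[OF rx] by (auto simp: F_def A_def disc_embeddings_def)
  have f: "f holomorphic_on A" "inj_on f A" "f ` A \<subseteq> ball 0 1" "f x = 0"
    using f by (auto simp: A_def disc_embeddings_def)

  \<comment> \<open>The difference quotient at x is holomorphic across x and has no zeros, by
    injectivity and nonvanishing of the derivative. Since f and F both vanish at x, the ratio of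
    their quotients extends f / F without zeros.\<close>
  define quot where "quot = (\<lambda>(h::complex \<Rightarrow> complex) (z::complex). if z = of_real x then deriv h x else (h z - h x) / (z - x))"
  have quot: "quot h holomorphic_on A" "\<And>z. z \<in> A \<Longrightarrow> quot h z \<noteq> 0"
    if "h holomorphic_on A" "inj_on h A" for h
  proof -
    show "quot h holomorphic_on A"
      unfolding quot_def by (rule pole_lemma_open[OF that(1) open_A])
    show "quot h z \<noteq> 0" if "z \<in> A" for z
      using holomorphic_injective_imp_regular[OF \<open>h holomorphic_on A\<close> open_A \<open>inj_on h A\<close> xA]
        inj_onD[OF \<open>inj_on h A\<close> _ that xA] unfolding quot_def by auto
  qed
  define k where "k = (\<lambda>z. quot f z / quot F z)"
  have k: "k holomorphic_on A" "\<And>z. z \<in> A \<Longrightarrow> k z \<noteq> 0"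
    using quot[OF f(1,2)] quot[OF F(1,2)] unfolding k_def by (auto intro!: holomorphic_intros)
  obtain c :: real and m :: int where
    cm: "\<And>\<rho>. r < \<rho> \<Longrightarrow> \<rho> < 1 \<Longrightarrow> \<exists>z. norm z = \<rho> \<and> ln (norm (k z)) = c + m * ln \<rho>"
    using log_norm_mean_annulus[of k r] k rx unfolding A_def by (metis order.strict_trans)
  have k_eq: "norm (k z) = norm (f z) / norm (F z)" if "norm z \<noteq> x" for z
    using that \<open>0 < x\<close> f(4) F(4) by (auto simp: k_def quot_def norm_divide)

  have norm_F: "continuous_on {z. r \<le> norm z \<and> norm z \<le> 1} (\<lambda>z. norm (F z))"
  proof -
    have "r\<^sup>2 / x < r" "1 < 1 / x" using rx by (auto simp: power2_eq_square field_simps)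
    then have "F holomorphic_on {z. r \<le> norm z \<and> norm z \<le> 1}"
      unfolding F_def by (intro holomorphic_on_subset[OF holomorphic_slit_map[OF rx]]) auto
    then show ?thesis
      by (intro continuous_on_norm holomorphic_on_imp_continuous_on)
  qed
  \<comment> \<open>The alternatives belong to m >= 0 and m < 0, with e absorbing the errors of |F|
    and of the radii near the boundary.\<close>
  have approx: "s * (1 - e) \<le> x + e \<or> s * (x - e) * (1 - e) \<le> r + e" if e: "0 < e" "e < x" for e
  proof -
    have e1: "e < 1" using e x by simp
    have r1: "r \<le> 1" using rx by simp
    obtain d1 where d1: "0 < d1" "\<And>z. r \<le> norm z \<Longrightarrow> norm z \<le> 1 \<Longrightarrow> \<bar>norm z - 1\<bar> < d1 \<Longrightarrow> \<bar>norm (F z) - 1\<bar> < e"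
      using near_circle[OF norm_F rx(1) r1 order_refl _ e(1), of 1] norm_slit_map_outer[OF rx]
      unfolding F_def by blast
    obtain d2 where d2: "0 < d2" "\<And>z. r \<le> norm z \<Longrightarrow> norm z \<le> 1 \<Longrightarrow> \<bar>norm z - r\<bar> < d2 \<Longrightarrow> \<bar>norm (F z) - x\<bar> < e"
      using near_circle[OF norm_F rx(1) order_refl r1 _ e(1), of x] norm_slit_map_inner[OF rx]
      unfolding F_def by blast
    obtain d3 where d3: "0 < d3" "\<And>z. z \<in> A \<Longrightarrow> norm z < r + d3 \<or> 1 - d3 < norm z \<Longrightarrow> s < norm (f z)"
      using embedding_near_boundary[of f r t s] f(1,2) t s rx unfolding A_def by auto
    \<comment> \<open>Halving the minimum makes all bounds strict; the last two give r + d < x < 1 -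
      d, so neither circle meets the point x.\<close>
    define d where "d = Min {d1, d2, d3, e, x - r, 1 - x} / 2"
    have d: "0 < d" "d < d1" "d < d2" "d < d3" "d < e" "d < x - r" "d < 1 - x"
      unfolding d_def using d1 d2 d3 e rx by auto
    obtain z1 where z1: "norm z1 = r + d" "ln (norm (k z1)) = c + m * ln (r + d)"
      using cm[of "r + d"] d rx by auto
    obtain z2 where z2: "norm z2 = 1 - d" "ln (norm (k z2)) = c + m * ln (1 - d)"
      using cm[of "1 - d"] d rx by auto
    have A12: "z1 \<in> A" "z2 \<in> A" using z1 z2 d rx by (auto simp: A_def annulus_def)
    have F1: "x - e < norm (F z1)" "norm (F z1) < x + e" and f1: "s < norm (f z1)" "norm (f z1) < 1"
      using d2(2)[of z1] d3(2)[of z1] z1 d rx A12 f(3) by auto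
    have F2: "1 - e < norm (F z2)" "norm (F z2) < 1" and f2: "s < norm (f z2)" "norm (f z2) < 1"
      using d1(2)[of z2] d3(2)[of z2] z2 d rx A12 f(3) F(3) by auto
    have k1: "norm (k z1) = norm (f z1) / norm (F z1)" and k2: "norm (k z2) = norm (f z2) / norm (F z2)"
      using k_eq z1 z2 d by auto
    have pos: "0 < norm (k z1)" "0 < norm (k z2)"
      using k(2) A12 by auto
    have "0 < s" using s \<open>0 < x\<close> by simp
    have F_pos: "0 < norm (F z1)" "0 < norm (F z2)" "0 < x - e" "0 < 1 - e"
      using F1 F2 e e1 by linarith+
    have k1_lower: "s / (x + e) \<le> norm (k z1)" and k1_upper: "norm (k z1) \<le> 1 / (x - e)"
      and k2_lower: "s / 1 \<le> norm (k z2)" and k2_upper: "norm (k z2) \<le> 1 / (1 - e)"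
      unfolding k1 k2 by (rule frac_le; use F_pos F1 f1 F2 f2 \<open>0 < s\<close> in linarith)+
    have ln_le: "ln (r + d) \<le> ln (1 - d)"
      using d rx by (subst ln_le_cancel_iff) auto
    show ?thesis
    proof (cases "0 \<le> m") \<comment> \<open>\<open>m\<close> is negative when \<open>f\<close> exchanges the two boundary components\<close>
      case True
      then have "ln (norm (k z1)) \<le> ln (norm (k z2))"
        using ln_le z1 z2 by (simp add: mult_left_mono)
      then have "s / (x + e) \<le> 1 / (1 - e)"
        using pos k1_lower k2_upper by (simp add: ln_le_cancel_iff)
      then show ?thesis
        using e e1 \<open>0 < x\<close> by (simp add: field_simps)
    next
      case False
      \<comment> \<open>Integrality of m gives m <= -1, so |k| decreases from the inner to the outer
        circle at least by the ratio of the radii.\<close>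
      then have "real_of_int m \<le> - 1" by linarith
      then have "m * (ln (1 - d) - ln (r + d)) \<le> - 1 * (ln (1 - d) - ln (r + d))"
        using ln_le by (intro mult_right_mono) auto
      then have "ln (norm (k z2)) + ln (1 - d) \<le> ln (norm (k z1)) + ln (r + d)"
        using z1 z2 by (simp add: algebra_simps)
      then have "norm (k z2) * (1 - d) \<le> norm (k z1) * (r + d)"
        using pos d rx by (simp flip: ln_mult_pos)
      also have "\<dots> \<le> 1 / (x - e) * (r + e)"
        using k1_upper d rx e by (intro mult_mono) auto
      finally have "norm (k z2) * (1 - d) \<le> (r + e) / (x - e)" by simp
      moreover have "s * (1 - e) \<le> norm (k z2) * (1 - d)"
        using k2_lower d e1 \<open>0 < s\<close> by (intro mult_mono) auto
      ultimately have "s * (1 - e) \<le> (r + e) / (x - e)" by linarith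
      then show ?thesis using e by (simp add: field_simps)
    qed
  qed
  \<comment> \<open>As e tends to 0 from the right, both alternatives fail because s > x and s x >
    x^2 >= r.\<close>
  have "\<forall>\<^sub>F e in at_right 0. s * (1 - e) \<le> x + e \<or> s * (x - e) * (1 - e) \<le> r + e"
    using approx \<open>0 < x\<close>
    by (intro eventually_at_rightI[of 0 x]) auto
  moreover have "\<forall>\<^sub>F e in at_right 0. x + e < s * (1 - e)"
  proof -
    have "((\<lambda>e. s * (1 - e) - (x + e)) \<longlongrightarrow> s * (1 - 0) - (x + 0)) (at_right 0)"
      by (intro tendsto_intros)
    then have "\<forall>\<^sub>F e in at_right 0. 0 < s * (1 - e) - (x + e)"
      using s by (intro order_tendstoD(1)) auto
    then show ?thesis by eventually_elim simp
  qed
  moreover have "\<forall>\<^sub>F e in at_right 0. r + e < s * (x - e) * (1 - e)"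
  proof -
    have "x * x < s * x" using s \<open>0 < x\<close> by simp
    have "((\<lambda>e. s * (x - e) * (1 - e) - (r + e)) \<longlongrightarrow> s * (x - 0) * (1 - 0) - (r + 0)) (at_right 0)"
      by (intro tendsto_intros)
    then have "\<forall>\<^sub>F e in at_right 0. 0 < s * (x - e) * (1 - e) - (r + e)"
      using \<open>x * x < s * x\<close> \<open>r \<le> x * x\<close> by (intro order_tendstoD(1)) auto
    then show ?thesis by eventually_elim simp
  qed
  ultimately have "\<forall>\<^sub>F e :: real in at_right 0. False"
    by eventually_elim linarith
  then show False by simp
qed

text \<open>The radius x is attained by the slit map and bounds the radii of all admissible
  embeddings, so both suprema are determined.\<close>

lemma squeezing_function_annulus:
  assumes r: "0 < r" "r < 1" and x: "sqrt r \<le> x" "x < 1"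
  shows "squeezing_function (annulus r) x = x"
proof -
  let ?T = "\<lambda>f. {t. 0 \<le> t \<and> ball 0 t \<subseteq> f ` annulus r}"
  have "0 < sqrt r" "sqrt r < 1" using r by auto
  \<comment> \<open>This is r < sqrt r, which supplies the strict inequality r < x demanded by the
    slit map.\<close>
  then have "sqrt r * sqrt r < 1 * sqrt r" by (intro mult_strict_right_mono)
  then have rx: "0 < r" "r < x" "x < 1" using r x by auto
  have bound: "t \<le> x" if "f \<in> disc_embeddings (annulus r) x" "t \<in> ?T f" for f t
    using squeezing_upper_bound[OF r(1) x that(1)] that(2) by auto
  have zero: "0 \<in> ?T f" for f by simp
  have "bdd_above (?T f)" if "f \<in> disc_embeddings (annulus r) x" for f
    using bound[OF that] by (rule bdd_aboveI)
  moreover have le: "Sup (?T f) \<le> x" if "f \<in> disc_embeddings (annulus r) x" for f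
    using zero bound[OF that] by (intro cSup_least) auto
  moreover have slit: "slit_map r x \<in> disc_embeddings (annulus r) x" "x \<in> ?T (slit_map r x)"
    using slit_map_embedding[OF rx] rx by auto
  ultimately have "x \<le> Sup (?T (slit_map r x))"
    by (intro cSup_upper)
  also have "\<dots> \<le> squeezing_function (annulus r) x"
    unfolding squeezing_function_def using slit(1) le by (intro cSUP_upper) (auto intro!: bdd_aboveI2)
  finally have "x \<le> squeezing_function (annulus r) x" .
  moreover have "squeezing_function (annulus r) x \<le> x"
    unfolding squeezing_function_def using slit(1) le by (intro cSUP_least) auto
  ultimately show ?thesis by simp
qed

theorem theorem6p3:
  fixes r :: real
  assumes "0 < r" and "r < 1"
  shows "strict_mono_on {sqrt r..<1} (\<lambda>x. squeezing_function (annulus r) (complex_of_real x))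
    \<and> (\<forall>x\<in>{sqrt r..<1}. squeezing_function (annulus r) (complex_of_real (sqrt r))
           \<le> squeezing_function (annulus r) (complex_of_real x))"
  using assms by (auto simp: squeezing_function_annulus intro!: strict_mono_onI)

end
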